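(* Let a Schrödinger potential $p(t)$ in the equation $\ddot x+p(t)x=0$ be given. Associate with $p$ the front wheel path $(X(t),Y(t))$ as follows: defining $$\varphi(t)=t+\int_0^t p(s)\,ds,$$ set $$X(t)=-\int_0^t (1-p(\tau))\sin\varphi(\tau)\,d\tau,\qquad Y(t)=\int_0^t (1-p(\tau))\cos\varphi(\tau)\,d\tau .$$ If the potential $p$ and the path $(X,Y)$ are thus related, then the corresponding Schrödinger equation $\ddot x+p(t)x=0$ and the bike problem $\dot\theta=\dot Y\cos\theta-\dot X\sin\theta$ are equivalent in the sense that $$\theta=2\arg(x+i\dot x)+\varphi .$$ More precisely, for a solution $x$ of the Schrödinger equation and a solution $\theta$ of the bike equation, if this relation holds for $t=0$, then it holds for all $t$.
   Context: Dots denote derivatives with respect to $t$. The stationary Schrödinger equation (Hill's equation) with potential $p(t)$ is $\ddot x+p(t)x=0$. The bike problem: a segment $RF$ of constant length moves in the plane so that its front end $F$ follows a prescribed path $(X(t),Y(t))$ (the front wheel path), while the velocity of the rear end $R$ is constrained to the line $RF$. The angle $\theta$ between $RF$ and the $x$-axis then satisfies the differential equation $\dot\theta=\dot Y\cos\theta-\dot X\sin\theta$, which is the bike problem (bike equation) with front wheel path $(X,Y)$. In the relation between $\theta$ and $x$, the solution $x$ is understood to be real and not identically zero, so that $x+i\dot x$ has an argument, and $\arg$ is followed continuously in $t$. *)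

theory Defs
  imports "HOL-Analysis.Analysis"
begin

text \<open>Integrals are the oriented interval integrals of the library, so negative \<open>t\<close> is covered.\<close>

definition phase :: "(real \<Rightarrow> real) \<Rightarrow> real \<Rightarrow> real" where
  "phase p t = t + (LBINT s=0..ereal t. p s)"

definition front_X :: "(real \<Rightarrow> real) \<Rightarrow> real \<Rightarrow> real" where
  "front_X p t = - (LBINT \<tau>=0..ereal t. (1 - p \<tau>) * sin (phase p \<tau>))"

definition front_Y :: "(real \<Rightarrow> real) \<Rightarrow> real \<Rightarrow> real" where
  "front_Y p t = (LBINT \<tau>=0..ereal t. (1 - p \<tau>) * cos (phase p \<tau>))"

definition schrodinger_solution :: "(real \<Rightarrow> real) \<Rightarrow> (real \<Rightarrow> real) \<Rightarrow> bool" where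
  "schrodinger_solution p x \<longleftrightarrow>
     (\<forall>t. x differentiable (at t) \<and> deriv x differentiable (at t) \<and>
          deriv (deriv x) t + p t * x t = 0)"

definition bike_solution :: "(real \<Rightarrow> real) \<Rightarrow> (real \<Rightarrow> real) \<Rightarrow> (real \<Rightarrow> real) \<Rightarrow> bool" where
  "bike_solution X Y \<theta> \<longleftrightarrow>
     (\<forall>t. \<theta> differentiable (at t) \<and>
          deriv \<theta> t = deriv Y t * cos (\<theta> t) - deriv X t * sin (\<theta> t))"

text \<open>A continuous choice of argument along a curve. The library predicate \<open>is_Arg\<close> accepts
  every angle at the origin, hence the requirement that the curve avoid it.\<close>

definition continuous_arg :: "(real \<Rightarrow> complex) \<Rightarrow> (real \<Rightarrow> real) \<Rightarrow> bool" where
  "continuous_arg z \<alpha> \<longleftrightarrow>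
     continuous_on UNIV \<alpha> \<and> (\<forall>t. z t \<noteq> 0 \<and> is_Arg (z t) (\<alpha> t))"

definition phase_curve :: "(real \<Rightarrow> real) \<Rightarrow> real \<Rightarrow> complex" where
  "phase_curve x t = Complex (x t) (deriv x t)"

end

theory Submission imports Defs begin

text \<open>Writing \<open>x + i x' = r e\<^sup>i\<^sup>\<alpha>\<close>, the Schroedinger equation becomes
  \<open>\<alpha>' = - (p cos\<^sup>2 \<alpha> + sin\<^sup>2 \<alpha>)\<close> together with \<open>r' = (1 - p) r sin \<alpha> cos \<alpha>\<close>. Since
  \<open>\<phi>' = 1 + p\<close>, the angle \<open>\<theta> = 2 \<alpha> + \<phi>\<close> satisfies
  \<open>\<theta>' = (1 - p) cos (\<theta> - \<phi>)\<close>, which is the bike equation of the path \<open>(X, Y)\<close>.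
  The first equation does not involve \<open>r\<close>, so every solution \<open>\<theta>\<close> yields \<open>\<alpha>\<close>, and then
  \<open>r\<close> by a quadrature. A Gronwall estimate gives both the uniqueness of \<open>\<theta>\<close> and the fact
  that a nontrivial phase curve avoids the origin.\<close>

section \<open>Calculus: oriented integrals and a two-sided Gronwall estimate\<close>

lemma has_real_derivative_interval_integral:
  fixes f :: "real \<Rightarrow> real"
  assumes "continuous_on UNIV f"
  shows "((\<lambda>t. LBINT s=0..ereal t. f s) has_real_derivative f t) (at t)"
proof -
  \<comment> \<open>This choice puts both 0 and \<open>t\<close> in the interior of the interval,
    whatever the sign of \<open>t\<close>, so the one-interval derivative becomes a full
    one.\<close>
  define m where "m = \<bar>t\<bar> + 1"
  have "((\<lambda>u. LBINT s=ereal 0..ereal u. f s) has_vector_derivative f t) (at t within {-m..m})"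
    using assms by (intro interval_integral_FTC2) (auto simp: m_def intro: continuous_on_subset)
  moreover have "at t within {-m..m} = at t"
    by (rule at_within_interior) (auto simp: m_def)
  ultimately show ?thesis
    by (simp add: has_real_derivative_iff_has_vector_derivative zero_ereal_def)
qed

text \<open>With \<open>A\<close> an antiderivative of \<open>k\<close>, the bound makes
  \<open>w * exp (- A)\<close> nonincreasing and \<open>w * exp A\<close> nondecreasing. The first
  carries the zero at \<open>a\<close> forward in time, the second backward.\<close>

lemma gronwall_zero:
  fixes w w' k :: "real \<Rightarrow> real"
  assumes w: "\<And>t. (w has_real_derivative w' t) (at t)"
    and k: "continuous_on UNIV k"
    and bound: "\<And>t. \<bar>w' t\<bar> \<le> k t * w t"
    and nonneg: "\<And>t. 0 \<le> w t"
    and zero: "w a = 0"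
  shows "w t = 0"
proof -
  define A where "A t = (LBINT s=0..ereal t. k s)" for t
  have A: "(A has_real_derivative k t) (at t)" for t
    unfolding A_def by (rule has_real_derivative_interval_integral[OF k])
  have "w t \<le> 0"
  proof (cases "a \<le> t")
    case True
    have "w t * exp (- A t) \<le> w a * exp (- A a)"
    proof (rule DERIV_nonpos_imp_nonincreasing[OF True])
      fix s
      have "((\<lambda>s. w s * exp (- A s)) has_real_derivative (w' s - k s * w s) * exp (- A s)) (at s)"
        by (auto intro!: derivative_eq_intros w A simp: algebra_simps)
      moreover have "(w' s - k s * w s) * exp (- A s) \<le> 0"
        using bound[of s] by (intro mult_nonpos_nonneg) auto
      ultimately show "\<exists>y. ((\<lambda>s. w s * exp (- A s)) has_real_derivative y) (at s) \<and> y \<le> 0"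
        by blast
    qed
    then show ?thesis
      using zero by (simp add: mult_le_0_iff)
  next
    case False
    then have "t \<le> a" by simp
    then have "w t * exp (A t) \<le> w a * exp (A a)"
    proof (rule DERIV_nonneg_imp_nondecreasing)
      fix s
      have "((\<lambda>s. w s * exp (A s)) has_real_derivative (w' s + k s * w s) * exp (A s)) (at s)"
        by (auto intro!: derivative_eq_intros w A simp: algebra_simps)
      moreover have "0 \<le> (w' s + k s * w s) * exp (A s)"
        using bound[of s] by (intro mult_nonneg_nonneg) auto
      ultimately show "\<exists>y. ((\<lambda>s. w s * exp (A s)) has_real_derivative y) (at s) \<and> 0 \<le> y"
        by blast
    qed
    then show ?thesis
      using zero by (simp add: mult_le_0_iff)
  qed
  then show ?thesis
    using nonneg[of t] by simp
qed

section \<open>Schroedinger solutions as planar curves\<close>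

lemma schrodinger_solutionD:
  assumes "schrodinger_solution p x"
  shows "(x has_real_derivative deriv x t) (at t)"
    and "(deriv x has_real_derivative - p t * x t) (at t)"
proof -
  have "x differentiable at t" "deriv x differentiable at t"
    and eq: "deriv (deriv x) t + p t * x t = 0"
    using assms by (auto simp: schrodinger_solution_def)
  then show "(x has_real_derivative deriv x t) (at t)"
    by (simp add: DERIV_deriv_iff_real_differentiable)
  have "deriv (deriv x) t = - p t * x t"
    using eq by simp
  with \<open>deriv x differentiable at t\<close> show "(deriv x has_real_derivative - p t * x t) (at t)"
    by (metis DERIV_deriv_iff_real_differentiable)
qed

lemma schrodinger_solutionI:
  assumes "\<And>t. (x has_real_derivative y t) (at t)"
    and "\<And>t. (y has_real_derivative - p t * x t) (at t)"
  shows "schrodinger_solution p x"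
proof -
  have "deriv x = y"
    using assms(1) by (auto intro: DERIV_imp_deriv)
  moreover have "deriv y t = - p t * x t" for t
    using assms(2) by (rule DERIV_imp_deriv)
  ultimately show ?thesis
    using assms by (auto simp: schrodinger_solution_def real_differentiable_def)
qed

text \<open>The squared modulus \<open>w\<close> of the phase curve has derivative (1 - p) 2 x x',
  and 2 |x x'| \<le> w. By Gronwall a single zero of the curve would spread to all times, including
  \<open>s\<close>.\<close>

lemma phase_curve_nonzero:
  assumes p: "continuous_on UNIV p" and x: "schrodinger_solution p x" and nz: "x s \<noteq> 0"
  shows "phase_curve x t \<noteq> 0"
proof
  assume "phase_curve x t = 0"
  then have t: "x t = 0" "deriv x t = 0"
    by (auto simp: phase_curve_def complex_eq_iff)
  define w where "w t = (x t)\<^sup>2 + (deriv x t)\<^sup>2" for t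
  have "w s = 0"
  proof (rule gronwall_zero[where w = w])
    fix u
    show "(w has_real_derivative (1 - p u) * (2 * (x u * deriv x u))) (at u)"
      unfolding w_def
      by (auto intro!: derivative_eq_intros schrodinger_solutionD[OF x] simp: algebra_simps)
    have "2 * \<bar>x u * deriv x u\<bar> \<le> w u"
      using sum_squares_bound[of "\<bar>x u\<bar>" "\<bar>deriv x u\<bar>"] by (simp add: w_def abs_mult)
    then have "\<bar>1 - p u\<bar> * (2 * \<bar>x u * deriv x u\<bar>) \<le> \<bar>1 - p u\<bar> * w u"
      by (rule mult_left_mono) simp
    then show "\<bar>(1 - p u) * (2 * (x u * deriv x u))\<bar> \<le> \<bar>1 - p u\<bar> * w u"
      by (simp only: abs_mult abs_numeral)
    show "0 \<le> w u"
      by (simp add: w_def)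
  next
    show "continuous_on UNIV (\<lambda>u. \<bar>1 - p u\<bar>)"
      by (intro continuous_intros p)
    show "w t = 0"
      using t by (simp add: w_def)
  qed
  with nz show False
    by (simp add: w_def sum_power2_eq_zero_iff)
qed

section \<open>Continuous arguments: existence and differentiability\<close>

text \<open>The real line is contractible, so a curve avoiding the origin has a continuous
  logarithm; its imaginary part is the argument.\<close>

lemma continuous_arg_exists:
  fixes z :: "real \<Rightarrow> complex"
  assumes "continuous_on UNIV z" and "\<And>t. z t \<noteq> 0"
  shows "\<exists>\<alpha>. continuous_arg z \<alpha>"
proof -
  obtain g where g: "continuous_on UNIV g" "\<And>t. z t = exp (g t)"
    using continuous_logarithm_on_contractible[OF assms(1) contractible_UNIV] assms(2) by auto
  have "is_Arg (z t) (Im (g t))" for t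
    by (simp add: is_Arg_def g(2) norm_mult exp_eq_polar[of "g t"] flip: cis_conv_exp)
  then have "continuous_arg z (\<lambda>t. Im (g t))"
    unfolding continuous_arg_def using g(1) assms(2) by (simp add: continuous_on_Im)
  then show ?thesis by blast
qed

lemma continuous_on_phase_curve:
  assumes "schrodinger_solution p x"
  shows "continuous_on UNIV (phase_curve x)"
  unfolding phase_curve_def
  using schrodinger_solutionD[OF assms]
  by (intro continuous_on_Complex) (meson DERIV_isCont continuous_at_imp_continuous_on)+

text \<open>Near \<open>t\<close>, continuity identifies \<open>\<alpha> s - \<alpha> t\<close> with the arctangent of the quotient of
  the cross and dot products of the vectors at \<open>t\<close> and \<open>s\<close>.\<close>

lemma continuous_arg_has_derivative:
  assumes x: "(x has_real_derivative x') (at t)" and y: "(y has_real_derivative y') (at t)"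
    and arg: "continuous_arg (\<lambda>s. Complex (x s) (y s)) \<alpha>"
  shows "(\<alpha> has_real_derivative (x t * y' - y t * x') / ((x t)\<^sup>2 + (y t)\<^sup>2)) (at t)"
proof -
  define r where "r s = cmod (Complex (x s) (y s))" for s
  have r: "0 < r s" "x s = r s * cos (\<alpha> s)" "y s = r s * sin (\<alpha> s)" for s
    using arg by (auto simp: continuous_arg_def is_Arg_def r_def complex_eq_iff Re_exp Im_exp)
  define N where "N s = x t * y s - y t * x s" for s
  define D where "D s = x t * x s + y t * y s" for s
  have N: "N s = r t * r s * sin (\<alpha> s - \<alpha> t)" and D: "D s = r t * r s * cos (\<alpha> s - \<alpha> t)" for s
    by (simp_all add: N_def D_def r(2,3) sin_diff cos_diff algebra_simps)
  have D_t: "D t = (x t)\<^sup>2 + (y t)\<^sup>2"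
    by (simp add: D_def power2_eq_square)
  have "D t \<noteq> 0"
    using r(1)[of t] by (simp add: D)
  have "((\<lambda>s. \<alpha> t + arctan (N s / D s)) has_real_derivative
      (x t * y' - y t * x') / ((x t)\<^sup>2 + (y t)\<^sup>2)) (at t)"
  proof -
    have dN: "(N has_real_derivative x t * y' - y t * x') (at t)"
      unfolding N_def by (auto intro!: derivative_eq_intros x y)
    have dD: "(D has_real_derivative x t * x' + y t * y') (at t)"
      unfolding D_def by (auto intro!: derivative_eq_intros x y)
    \<comment> \<open>Since \<open>N\<close> vanishes at \<open>t\<close>, the quotient has
      derivative N'(t) / D(t) there, and arctan has slope 1 at 0.\<close>
    have "N t = 0"
      by (simp add: N)
    then show ?thesis
      using \<open>D t \<noteq> 0\<close> by (auto intro!: derivative_eq_intros dN dD simp flip: D_t)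
  qed
  moreover have "\<forall>\<^sub>F s in nhds t. \<alpha> t + arctan (N s / D s) = \<alpha> s"
  proof -
    have "isCont \<alpha> t"
      using arg by (simp add: continuous_arg_def continuous_on_eq_continuous_at)
    then have "(\<alpha> \<longlongrightarrow> \<alpha> t) (nhds t)"
      by (simp add: isCont_def tendsto_at_iff_tendsto_nhds)
    \<comment> \<open>Within distance pi / 2 of 0, arctan inverts tan, which excludes jumps by
      multiples of pi.\<close>
    then have "\<forall>\<^sub>F s in nhds t. dist (\<alpha> s) (\<alpha> t) < pi / 2"
      by (rule tendstoD) simp
    then show ?thesis
    proof eventually_elim
      case (elim s)
      have "N s / D s = tan (\<alpha> s - \<alpha> t)"
        using r(1)[of t] r(1)[of s] by (simp add: N D tan_def)
      moreover have "- (pi / 2) < \<alpha> s - \<alpha> t" "\<alpha> s - \<alpha> t < pi / 2"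
        using elim unfolding dist_real_def by linarith+
      ultimately show ?case
        by (simp add: arctan_tan)
    qed
  qed
  ultimately show ?thesis
    by (simp cong: DERIV_cong_ev)
qed

section \<open>The bike equation in terms of the phase\<close>

lemma phase_has_derivative:
  assumes "continuous_on UNIV p"
  shows "(phase p has_real_derivative 1 + p t) (at t)"
  unfolding phase_def
  by (auto intro!: derivative_eq_intros has_real_derivative_interval_integral assms)

text \<open>The path has velocity (1 - p) (-sin \<phi>, cos \<phi>), so the subtraction formula for
  the cosine collapses the right-hand side to a function of \<theta> - \<phi>.\<close>

lemma bike_solution_iff:
  assumes p: "continuous_on UNIV p"
  shows "bike_solution (front_X p) (front_Y p) \<theta> \<longleftrightarrow>
    (\<forall>t. (\<theta> has_real_derivative (1 - p t) * cos (\<theta> t - phase p t)) (at t))"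
proof -
  have phase: "continuous_on UNIV (phase p)"
    using phase_has_derivative[OF p] by (meson DERIV_isCont continuous_at_imp_continuous_on)
  have X: "(front_X p has_real_derivative - ((1 - p t) * sin (phase p t))) (at t)" for t
    unfolding front_X_def
    by (intro DERIV_minus has_real_derivative_interval_integral continuous_intros p phase)
  have Y: "(front_Y p has_real_derivative (1 - p t) * cos (phase p t)) (at t)" for t
    unfolding front_Y_def
    by (intro has_real_derivative_interval_integral continuous_intros p phase)
  have "deriv (front_Y p) t * cos (\<theta> t) - deriv (front_X p) t * sin (\<theta> t)
      = (1 - p t) * cos (\<theta> t - phase p t)" for t
    by (simp add: DERIV_imp_deriv[OF X] DERIV_imp_deriv[OF Y] cos_diff algebra_simps)
  then show ?thesis
    unfolding bike_solution_def
    by (metis DERIV_deriv_iff_real_differentiable DERIV_imp_deriv)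
qed

text \<open>The right-hand side is Lipschitz in \<theta> with constant |1 - p|. Gronwall is applied
  to the squared difference, which is differentiable and nonnegative.\<close>

lemma bike_solution_unique:
  assumes p: "continuous_on UNIV p"
    and \<theta>: "bike_solution (front_X p) (front_Y p) \<theta>"
    and \<psi>: "bike_solution (front_X p) (front_Y p) \<psi>"
    and init: "\<theta> a = \<psi> a"
  shows "\<theta> t = \<psi> t"
proof -
  define c where "c \<theta> t = cos (\<theta> t - phase p t)" for \<theta> t
  have "(\<theta> t - \<psi> t)\<^sup>2 = 0"
  proof (rule gronwall_zero[where w = "\<lambda>t. (\<theta> t - \<psi> t)\<^sup>2"])
    fix t
    have d: "(\<theta> has_real_derivative (1 - p t) * c \<theta> t) (at t)"
      "(\<psi> has_real_derivative (1 - p t) * c \<psi> t) (at t)"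
      using \<theta> \<psi> by (simp_all add: bike_solution_iff[OF p] c_def)
    show "((\<lambda>t. (\<theta> t - \<psi> t)\<^sup>2) has_real_derivative
        2 * (\<theta> t - \<psi> t) * ((1 - p t) * (c \<theta> t - c \<psi> t))) (at t)"
      by (auto intro!: derivative_eq_intros d simp: algebra_simps)
    have "\<bar>c \<theta> t - c \<psi> t\<bar> \<le> \<bar>\<theta> t - \<psi> t\<bar>"
    proof -
      \<comment> \<open>In the product form of the difference, one sine is bounded by 1 and the
        other by its argument.\<close>
      have "\<bar>c \<theta> t - c \<psi> t\<bar> = 2 * \<bar>sin ((\<theta> t - phase p t + (\<psi> t - phase p t)) / 2)\<bar>
          * \<bar>sin ((\<psi> t - \<theta> t) / 2)\<bar>"
        by (simp add: c_def cos_diff_cos abs_mult)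
      also have "\<dots> \<le> 2 * 1 * \<bar>(\<psi> t - \<theta> t) / 2\<bar>"
        by (intro mult_mono abs_sin_x_le_abs_x) auto
      finally show ?thesis by simp
    qed
    then have "2 * \<bar>1 - p t\<bar> * \<bar>\<theta> t - \<psi> t\<bar> * \<bar>c \<theta> t - c \<psi> t\<bar>
        \<le> 2 * \<bar>1 - p t\<bar> * \<bar>\<theta> t - \<psi> t\<bar> * \<bar>\<theta> t - \<psi> t\<bar>"
      by (intro mult_left_mono) auto
    moreover have "\<bar>2 * (\<theta> t - \<psi> t) * ((1 - p t) * (c \<theta> t - c \<psi> t))\<bar>
        = 2 * \<bar>1 - p t\<bar> * \<bar>\<theta> t - \<psi> t\<bar> * \<bar>c \<theta> t - c \<psi> t\<bar>"
      by (simp only: abs_mult) simp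
    moreover have "2 * \<bar>1 - p t\<bar> * \<bar>\<theta> t - \<psi> t\<bar> * \<bar>\<theta> t - \<psi> t\<bar>
        = 2 * \<bar>1 - p t\<bar> * (\<theta> t - \<psi> t)\<^sup>2"
      by (simp add: power2_eq_square)
    ultimately show "\<bar>2 * (\<theta> t - \<psi> t) * ((1 - p t) * (c \<theta> t - c \<psi> t))\<bar>
        \<le> 2 * \<bar>1 - p t\<bar> * (\<theta> t - \<psi> t)\<^sup>2"
      by (simp only:)
    show "0 \<le> (\<theta> t - \<psi> t)\<^sup>2"
      by simp
  next
    show "continuous_on UNIV (\<lambda>t. 2 * \<bar>1 - p t\<bar>)"
      by (intro continuous_intros p)
    show "(\<theta> a - \<psi> a)\<^sup>2 = 0"
      using init by simp
  qed
  then show ?thesis by simp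
qed

section \<open>Passing between the two equations\<close>

lemma bike_solution_of_schrodinger:
  assumes p: "continuous_on UNIV p" and x: "schrodinger_solution p x"
    and arg: "continuous_arg (phase_curve x) \<alpha>"
  shows "bike_solution (front_X p) (front_Y p) (\<lambda>t. 2 * \<alpha> t + phase p t)"
  unfolding bike_solution_iff[OF p]
proof
  fix t
  define r where "r = cmod (phase_curve x t)"
  have r: "0 < r" "x t = r * cos (\<alpha> t)" "deriv x t = r * sin (\<alpha> t)"
    using arg by (auto simp: continuous_arg_def is_Arg_def r_def phase_curve_def complex_eq_iff
        Re_exp Im_exp)
  have "(x t)\<^sup>2 + (deriv x t)\<^sup>2 = r\<^sup>2"
    by (simp add: r(2,3) power_mult_distrib flip: distrib_left)
  \<comment> \<open>This is the numerator x y' - y x' of the derivative of the argument, for y = x'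
    and y' = - p x.\<close>
  moreover have "x t * (- p t * x t) - deriv x t * deriv x t
      = - (p t * (cos (\<alpha> t))\<^sup>2 + (sin (\<alpha> t))\<^sup>2) * r\<^sup>2"
    by (simp add: r(2,3) power2_eq_square algebra_simps)
  ultimately have "(x t * (- p t * x t) - deriv x t * deriv x t) / ((x t)\<^sup>2 + (deriv x t)\<^sup>2)
      = - (p t * (cos (\<alpha> t))\<^sup>2 + (sin (\<alpha> t))\<^sup>2)"
    using r(1) by simp
  moreover have "continuous_arg (\<lambda>s. Complex (x s) (deriv x s)) \<alpha>"
    using arg by (simp add: phase_curve_def[abs_def])
  ultimately have \<alpha>: "(\<alpha> has_real_derivative - (p t * (cos (\<alpha> t))\<^sup>2 + (sin (\<alpha> t))\<^sup>2)) (at t)"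
    using continuous_arg_has_derivative[OF schrodinger_solutionD[OF x], of \<alpha> t] by simp
  have "2 * - (p t * (cos (\<alpha> t))\<^sup>2 + (sin (\<alpha> t))\<^sup>2) + (1 + p t) = (1 - p t) * cos (2 * \<alpha> t)"
    unfolding cos_double cos_squared_eq by (simp add: algebra_simps)
  then show "((\<lambda>t. 2 * \<alpha> t + phase p t) has_real_derivative
      (1 - p t) * cos (2 * \<alpha> t + phase p t - phase p t)) (at t)"
    by (auto intro!: derivative_eq_intros \<alpha> phase_has_derivative[OF p])
qed

text \<open>The desired relation forces \<alpha>, and the equation for the modulus then determines
  the solution up to a positive factor.\<close>

lemma schrodinger_of_bike_solution:
  assumes p: "continuous_on UNIV p" and \<theta>: "bike_solution (front_X p) (front_Y p) \<theta>"
  obtains x \<alpha> where "schrodinger_solution p x"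
    and "continuous_arg (phase_curve x) \<alpha>" and "\<And>t. \<theta> t = 2 * \<alpha> t + phase p t"
proof -
  define \<alpha> where "\<alpha> t = (\<theta> t - phase p t) / 2" for t
  have \<alpha>: "(\<alpha> has_real_derivative - (p t * (cos (\<alpha> t))\<^sup>2 + (sin (\<alpha> t))\<^sup>2)) (at t)" for t
  proof -
    have "(\<theta> has_real_derivative (1 - p t) * cos (2 * \<alpha> t)) (at t)"
    proof -
      have "2 * \<alpha> t = \<theta> t - phase p t"
        by (simp add: \<alpha>_def)
      then show ?thesis
        using \<theta> by (simp add: bike_solution_iff[OF p])
    qed
    then have "((\<lambda>t. (\<theta> t - phase p t) / 2) has_real_derivative
        ((1 - p t) * cos (2 * \<alpha> t) - (1 + p t)) / 2) (at t)"
      by (intro DERIV_cdivide DERIV_diff phase_has_derivative[OF p])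
    moreover have "((1 - p t) * cos (2 * \<alpha> t) - (1 + p t)) / 2
        = - (p t * (cos (\<alpha> t))\<^sup>2 + (sin (\<alpha> t))\<^sup>2)"
      unfolding cos_double cos_squared_eq by (simp add: field_simps)
    moreover have "(\<lambda>t. (\<theta> t - phase p t) / 2) = \<alpha>"
      by (simp add: \<alpha>_def fun_eq_iff)
    ultimately show ?thesis
      by (simp only:)
  qed
  then have cont: "continuous_on UNIV \<alpha>"
    by (meson DERIV_isCont continuous_at_imp_continuous_on)
  \<comment> \<open>The logarithm of the modulus, from r' / r = (1 - p) sin \<alpha> cos \<alpha>,
    normalised to r = 1 at time 0. Its exponential keeps the curve off the origin.\<close>
  define R where "R t = (LBINT s=0..ereal t. (1 - p s) * sin (\<alpha> s) * cos (\<alpha> s))" for t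
  have R: "(R has_real_derivative (1 - p t) * sin (\<alpha> t) * cos (\<alpha> t)) (at t)" for t
    unfolding R_def
    by (intro has_real_derivative_interval_integral continuous_intros p cont)
  define x where "x t = exp (R t) * cos (\<alpha> t)" for t
  define y where "y t = exp (R t) * sin (\<alpha> t)" for t
  have x: "(x has_real_derivative y t) (at t)" for t
  proof -
    have "(x has_real_derivative
        exp (R t) * ((1 - p t) * sin (\<alpha> t) * cos (\<alpha> t)) * cos (\<alpha> t)
        + - sin (\<alpha> t) * - (p t * (cos (\<alpha> t))\<^sup>2 + (sin (\<alpha> t))\<^sup>2) * exp (R t)) (at t)"
      unfolding x_def[abs_def] by (intro DERIV_mult DERIV_fun_exp DERIV_fun_cos R \<alpha>)
    \<comment> \<open>The terms in \<open>p\<close> cancel, leaving exp R sin \<alpha> (cos^2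
      \<alpha> + sin^2 \<alpha>).\<close>
    also have "exp (R t) * ((1 - p t) * sin (\<alpha> t) * cos (\<alpha> t)) * cos (\<alpha> t)
        + - sin (\<alpha> t) * - (p t * (cos (\<alpha> t))\<^sup>2 + (sin (\<alpha> t))\<^sup>2) * exp (R t) = y t"
      unfolding y_def using sin_cos_squared_add[of "\<alpha> t"] by algebra
    finally show ?thesis .
  qed
  have y: "(y has_real_derivative - p t * x t) (at t)" for t
  proof -
    have "(y has_real_derivative
        exp (R t) * ((1 - p t) * sin (\<alpha> t) * cos (\<alpha> t)) * sin (\<alpha> t)
        + cos (\<alpha> t) * - (p t * (cos (\<alpha> t))\<^sup>2 + (sin (\<alpha> t))\<^sup>2) * exp (R t)) (at t)"
      unfolding y_def[abs_def] by (intro DERIV_mult DERIV_fun_exp DERIV_fun_sin R \<alpha>)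
    also have "exp (R t) * ((1 - p t) * sin (\<alpha> t) * cos (\<alpha> t)) * sin (\<alpha> t)
        + cos (\<alpha> t) * - (p t * (cos (\<alpha> t))\<^sup>2 + (sin (\<alpha> t))\<^sup>2) * exp (R t) = - p t * x t"
      unfolding x_def using sin_cos_squared_add[of "\<alpha> t"] by algebra
    finally show ?thesis .
  qed
  have deriv: "deriv x = y"
    using x by (auto intro: DERIV_imp_deriv)
  have polar: "phase_curve x t = of_real (exp (R t)) * exp (\<i> * of_real (\<alpha> t))" for t
    by (simp add: phase_curve_def deriv x_def y_def complex_eq_iff Re_exp Im_exp)
  have arg: "continuous_arg (phase_curve x) \<alpha>"
    unfolding continuous_arg_def is_Arg_def using cont by (simp add: polar norm_mult)
  show ?thesis
  proof
    show "schrodinger_solution p x"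
      using x y by (rule schrodinger_solutionI)
    show "continuous_arg (phase_curve x) \<alpha>"
      by (fact arg)
    show "\<theta> t = 2 * \<alpha> t + phase p t" for t
      by (simp add: \<alpha>_def field_simps)
  qed
qed

text \<open>The zero solution has its phase curve at the origin, where \<open>continuous_arg\<close>
  admits no argument.\<close>

lemma schrodinger_solution_nontrivial:
  assumes x: "schrodinger_solution p x" and arg: "continuous_arg (phase_curve x) \<alpha>"
  shows "\<exists>t. x t \<noteq> 0"
proof (rule ccontr)
  assume "\<not> ?thesis"
  then have "x = (\<lambda>_. 0)" by auto
  with arg show False
    by (simp add: continuous_arg_def phase_curve_def complex_eq_iff)
qed

theorem theorem1:
  fixes p :: "real \<Rightarrow> real"
  assumes "continuous_on UNIV p"
  shows
    "(\<forall>x. schrodinger_solution p x \<and> (\<exists>t. x t \<noteq> 0) \<longrightarrow>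
        (\<exists>\<alpha>. continuous_arg (phase_curve x) \<alpha>)) \<and>
     (\<forall>x \<alpha> \<theta>. schrodinger_solution p x \<and> (\<exists>t. x t \<noteq> 0) \<and>
        continuous_arg (phase_curve x) \<alpha> \<and>
        bike_solution (front_X p) (front_Y p) \<theta> \<and>
        \<theta> 0 = 2 * \<alpha> 0 + phase p 0 \<longrightarrow>
        (\<forall>t. \<theta> t = 2 * \<alpha> t + phase p t)) \<and>
     (\<forall>x \<alpha>. schrodinger_solution p x \<and> (\<exists>t. x t \<noteq> 0) \<and>
        continuous_arg (phase_curve x) \<alpha> \<longrightarrow>
        bike_solution (front_X p) (front_Y p) (\<lambda>t. 2 * \<alpha> t + phase p t)) \<and>
     (\<forall>\<theta>. bike_solution (front_X p) (front_Y p) \<theta> \<longrightarrow>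
        (\<exists>x \<alpha>. schrodinger_solution p x \<and> (\<exists>t. x t \<noteq> 0) \<and>
           continuous_arg (phase_curve x) \<alpha> \<and>
           (\<forall>t. \<theta> t = 2 * \<alpha> t + phase p t)))"
proof (intro conjI allI impI; (elim conjE)?)
  fix x
  assume x: "schrodinger_solution p x" and "\<exists>t. x t \<noteq> 0"
  then show "\<exists>\<alpha>. continuous_arg (phase_curve x) \<alpha>"
    using continuous_arg_exists[OF continuous_on_phase_curve[OF x]]
      phase_curve_nonzero[OF assms x] by blast
next
  fix x \<alpha> \<theta> t
  assume "schrodinger_solution p x" "continuous_arg (phase_curve x) \<alpha>"
    and "bike_solution (front_X p) (front_Y p) \<theta>" "\<theta> 0 = 2 * \<alpha> 0 + phase p 0"
  \<comment> \<open>Both sides solve the bike equation and agree at time 0, so uniqueness identifies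
    them.\<close>
  then show "\<theta> t = 2 * \<alpha> t + phase p t"
    using bike_solution_unique[OF assms _ bike_solution_of_schrodinger[OF assms]] by blast
next
  fix x \<alpha>
  assume "schrodinger_solution p x" "continuous_arg (phase_curve x) \<alpha>"
  then show "bike_solution (front_X p) (front_Y p) (\<lambda>t. 2 * \<alpha> t + phase p t)"
    by (rule bike_solution_of_schrodinger[OF assms])
next
  fix \<theta>
  assume "bike_solution (front_X p) (front_Y p) \<theta>"
  then obtain x \<alpha> where "schrodinger_solution p x" "continuous_arg (phase_curve x) \<alpha>"
    "\<And>t. \<theta> t = 2 * \<alpha> t + phase p t"
    using schrodinger_of_bike_solution[OF assms] by blast
  then show "\<exists>x \<alpha>. schrodinger_solution p x \<and> (\<exists>t. x t \<noteq> 0) \<and>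
      continuous_arg (phase_curve x) \<alpha> \<and> (\<forall>t. \<theta> t = 2 * \<alpha> t + phase p t)"
    using schrodinger_solution_nontrivial by blast
qed

end
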